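(* Let $f:\mathbb{R}^n\to\mathbb{R}$ be convex and $L$-smooth ($L>0$), with a minimizer $x^*$ and $f^*=f(x^* )$. Let $\{\eta_k\}_{k\ge0}$ be a monotonically decreasing sequence of positive stepsizes, and let $\{x_k\}_{k\ge0}$ be generated from $x_0,x_1\in\mathbb{R}^n$ by $$x_{k+1}=x_k+\frac{k}{k+2}(x_k-x_{k-1})-\frac{2\sqrt{\eta_k}}{(k+2)\sqrt{k}}\,g(x_k,\xi_k),\qquad k\ge1.$$ Define, for $k\ge0$, $$\mathcal{E}(k)=\left\|x_{k+1}+(k+1)(x_{k+1}-x_k)-x^*\right\|^2+4\sqrt{(k+1)\eta_k}\,(f(x_k)-f^* ).$$ Then for any $k\ge1$, $$\mathcal{E}(k)-\mathcal{E}(k-1)\le\frac{4\eta_k}{k}\|g(x_k,\xi_k)\|^2-\frac{2}{L}\sqrt{\frac{\eta_k}{k}}\|\nabla f(x_k)\|^2-2\sqrt{\frac{\eta_k}{k}}(f(x_k)-f^* )+4\sqrt{\frac{\eta_k}{k}}\langle\nabla f(x_k)-g(x_k,\xi_k),\tau_k\rangle,$$ where $\tau_k=k(x_k-x_{k-1})+(x_k-x^* )$.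
   Context: $\|\cdot\|$ and $\langle\cdot,\cdot\rangle$ are the Euclidean norm and inner product. $f$ is $L$-smooth if it is differentiable and $\|\nabla f(x)-\nabla f(y)\|\le L\|x-y\|$ for all $x,y\in\mathbb{R}^n$. $g(x_k,\xi_k)\in\mathbb{R}^n$ is the output of a stochastic gradient oracle queried at $x_k$ with randomness $\xi_k$; no assumption on its distribution is made in this statement, and the inequality holds pathwise. *)

theory Defs
  imports "HOL-Analysis.Analysis"
begin

definition gradient :: "('a::euclidean_space \<Rightarrow> real) \<Rightarrow> 'a \<Rightarrow> 'a" where
  "gradient f x = (THE D. GDERIV f x :> D)"

lemma GDERIV_unique:
  fixes f :: "'a::euclidean_space \<Rightarrow> real"
  assumes "GDERIV f x :> D" "GDERIV f x :> D'"
  shows "D = D'"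
proof -
  have "(\<lambda>h. h \<bullet> D) = (\<lambda>h. h \<bullet> D')"
    by (rule has_derivative_unique[OF assms[unfolded gderiv_def]])
  then have "\<forall>h. h \<bullet> D = h \<bullet> D'"
    by (simp add: fun_eq_iff)
  then show ?thesis
    by (simp only: vector_eq_ldot)
qed

lemma GDERIV_gradient:
  fixes f :: "'a::euclidean_space \<Rightarrow> real"
  assumes "f differentiable (at x)"
  shows "GDERIV f x :> gradient f x"
proof -
  obtain f' where f': "(f has_derivative f') (at x)"
    using assms unfolding differentiable_def by blast
  interpret linear f'
    using f' by (rule has_derivative_linear)
  define D where "D = (\<Sum>b\<in>Basis. f' b *\<^sub>R b)"
  have "f' h = h \<bullet> D" for h
  proof -
    have "f' h = f' (\<Sum>b\<in>Basis. (h \<bullet> b) *\<^sub>R b)"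
      by (simp add: euclidean_representation)
    also have "\<dots> = (\<Sum>b\<in>Basis. (h \<bullet> b) * f' b)"
      by (simp only: sum scale real_scaleR_def)
    also have "\<dots> = h \<bullet> D"
      by (simp add: D_def inner_sum_right mult.commute)
    finally show ?thesis .
  qed
  then have "f' = (\<lambda>h. h \<bullet> D)"
    by (rule ext)
  with f' have "GDERIV f x :> D"
    unfolding gderiv_def by simp
  then show ?thesis
    unfolding gradient_def by (rule theI) (rule GDERIV_unique[OF _ \<open>GDERIV f x :> D\<close>])
qed

definition L_smooth :: "real \<Rightarrow> ('a::euclidean_space \<Rightarrow> real) \<Rightarrow> bool" where
  "L_smooth L f \<longleftrightarrow>
     (\<forall>x. f differentiable (at x)) \<and>
     (\<forall>x y. norm (gradient f x - gradient f y) \<le> L * norm (x - y))"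

definition energy ::
    "('a::euclidean_space \<Rightarrow> real) \<Rightarrow> 'a \<Rightarrow> (nat \<Rightarrow> real) \<Rightarrow> (nat \<Rightarrow> 'a) \<Rightarrow> nat \<Rightarrow> real" where
  "energy f xstar \<eta> x k =
     (norm (x (k + 1) + real (k + 1) *\<^sub>R (x (k + 1) - x k) - xstar))\<^sup>2
     + 4 * sqrt (real (k + 1) * \<eta> k) * (f (x k) - f xstar)"

definition tau :: "'a::euclidean_space \<Rightarrow> (nat \<Rightarrow> 'a) \<Rightarrow> nat \<Rightarrow> 'a" where
  "tau xstar x k = real k *\<^sub>R (x k - x (k - 1)) + (x k - xstar)"

end

theory Submission
  imports Defs
begin

text \<open>The extrapolated points \<open>z\<^sub>k = x\<^sub>k + k (x\<^sub>k - x\<^sub>k\<^sub>-\<^sub>1)\<close> hidden in the energy turn the momentum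
  iteration into a plain gradient step: \<open>z\<^sub>k - x\<^sup>* = \<tau>\<^sub>k\<close> and \<open>z\<^sub>k\<^sub>+\<^sub>1 = z\<^sub>k - 2 s g\<^sub>k\<close> with
  \<open>s = sqrt (\<eta>\<^sub>k / k)\<close>.  Expanding the square \<open>\<parallel>\<tau>\<^sub>k - 2 s g\<^sub>k\<parallel>\<^sup>2\<close> gives exactly the noise terms of the bound,
  up to \<open>-4 s \<langle>\<nabla>f(x\<^sub>k), \<tau>\<^sub>k\<rangle>\<close>.

  That inner product splits along the two parts of \<open>\<tau>\<^sub>k\<close>.  Against \<open>x\<^sub>k - x\<^sub>k\<^sub>-\<^sub>1\<close>, convexity supplies
  \<open>f(x\<^sub>k) - f(x\<^sub>k\<^sub>-\<^sub>1)\<close>, whose coefficient \<open>4 s k = 4 sqrt (k \<eta>\<^sub>k)\<close> matches the potential term of the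
  previous energy because the step sizes decrease.  Against \<open>x\<^sub>k - x\<^sup>*\<close>, smoothness sharpens
  convexity (\<open>convex_L_smooth_lower_bound\<close>) to \<open>f(x\<^sub>k) - f\<^sup>* + \<parallel>\<nabla>f(x\<^sub>k)\<parallel>\<^sup>2 / (2 L)\<close>.  Of the resulting
  decrease \<open>4 s (f(x\<^sub>k) - f\<^sup>*)\<close>, half pays for the growth of the weight from \<open>sqrt k\<close> to
  \<open>sqrt (k + 1)\<close> (\<open>sqrt_weight_increment\<close>), and half remains in the bound.\<close>

lemma has_real_derivative_along_line:
  fixes f :: "'a::euclidean_space \<Rightarrow> real"
  assumes "f differentiable (at (x + t *\<^sub>R d))"
  shows "((\<lambda>t. f (x + t *\<^sub>R d)) has_real_derivative gradient f (x + t *\<^sub>R d) \<bullet> d) (at t)"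
proof -
  have "(f has_derivative (\<lambda>h. h \<bullet> gradient f (x + t *\<^sub>R d))) (at (x + t *\<^sub>R d))"
    using GDERIV_gradient[OF assms] unfolding gderiv_def .
  moreover have "((\<lambda>t. x + t *\<^sub>R d) has_derivative (\<lambda>h. h *\<^sub>R d)) (at t)"
    by (auto intro!: derivative_eq_intros)
  ultimately have "((\<lambda>t. f (x + t *\<^sub>R d)) has_derivative
      (\<lambda>h. (h *\<^sub>R d) \<bullet> gradient f (x + t *\<^sub>R d))) (at t)"
    by (rule has_derivative_compose[rotated])
  then show ?thesis
    by (simp add: has_field_derivative_def inner_commute mult_commute_abs)
qed

lemma convex_on_above_gradient:
  fixes f :: "'a::euclidean_space \<Rightarrow> real"
  assumes "convex_on UNIV f" and "f differentiable (at x)"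
  shows "f y \<ge> f x + gradient f x \<bullet> (y - x)"
proof -
  let ?\<phi> = "\<lambda>t. f (x + t *\<^sub>R (y - x))"
  have "convex_on UNIV ?\<phi>"
  proof (rule convex_onI)
    fix t a b :: real
    assume "0 < t" "t < 1"
    have "x + ((1 - t) *\<^sub>R a + t *\<^sub>R b) *\<^sub>R (y - x)
        = (1 - t) *\<^sub>R (x + a *\<^sub>R (y - x)) + t *\<^sub>R (x + b *\<^sub>R (y - x))"
      by (simp add: algebra_simps)
    then show "?\<phi> ((1 - t) *\<^sub>R a + t *\<^sub>R b) \<le> (1 - t) * ?\<phi> a + t * ?\<phi> b"
      using convex_onD[OF assms(1), of t] \<open>0 < t\<close> \<open>t < 1\<close> by simp
  qed simp
  moreover have "(?\<phi> has_real_derivative gradient f x \<bullet> (y - x)) (at 0)"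
    using has_real_derivative_along_line[of f x 0 "y - x"] assms(2) by simp
  ultimately have "?\<phi> 1 - ?\<phi> 0 \<ge> (gradient f x \<bullet> (y - x)) * (1 - 0)"
    by (intro convex_on_imp_above_tangent[where A = UNIV]) auto
  then show ?thesis by simp
qed

text \<open>The gap between \<open>f\<close> and its tangent grows along the segment at rate
  \<open>\<langle>\<nabla>f(x + t d) - \<nabla>f(x), d\<rangle> \<le> L t \<parallel>d\<parallel>\<^sup>2\<close>, so subtracting \<open>L t\<^sup>2 \<parallel>d\<parallel>\<^sup>2 / 2\<close> leaves a nonincreasing
  function of \<open>t\<close>.\<close>

lemma L_smooth_descent:
  fixes f :: "'a::euclidean_space \<Rightarrow> real"
  assumes "L_smooth L f"
  shows "f y \<le> f x + gradient f x \<bullet> (y - x) + L / 2 * (norm (y - x))\<^sup>2"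
proof -
  define d where "d = y - x"
  let ?\<phi> = "\<lambda>t. f (x + t *\<^sub>R d) - t * (gradient f x \<bullet> d) - L / 2 * t\<^sup>2 * (norm d)\<^sup>2"
  have "?\<phi> 1 \<le> ?\<phi> 0"
  proof (rule DERIV_nonpos_imp_nonincreasing[of 0 1])
    fix t :: real
    assume t: "0 \<le> t" "t \<le> 1"
    let ?D = "gradient f (x + t *\<^sub>R d) \<bullet> d - gradient f x \<bullet> d - L * t * (norm d)\<^sup>2"
    have diff: "f differentiable (at (x + t *\<^sub>R d))"
      using assms by (simp add: L_smooth_def)
    have "(?\<phi> has_real_derivative ?D) (at t)"
      by (rule derivative_eq_intros has_real_derivative_along_line[OF diff] refl)+ simp
    moreover have "?D \<le> 0"
    proof -
      have "(gradient f (x + t *\<^sub>R d) - gradient f x) \<bullet> d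
          \<le> norm (gradient f (x + t *\<^sub>R d) - gradient f x) * norm d"
        by (rule norm_cauchy_schwarz)
      also have "\<dots> \<le> (L * norm (t *\<^sub>R d)) * norm d"
        using assms unfolding L_smooth_def
        by (metis add_diff_cancel_left' mult_right_mono norm_ge_zero)
      finally show ?thesis
        using t by (simp add: inner_diff_left power2_eq_square mult.assoc)
    qed
    ultimately show "\<exists>D. (?\<phi> has_real_derivative D) (at t) \<and> D \<le> 0"
      by blast
  qed simp
  then show ?thesis by (simp add: d_def)
qed

text \<open>The tangent at \<open>x\<close> bounds \<open>f\<close> from below, and the quadratic of
  \<open>L_smooth_descent\<close> at \<open>y\<close> bounds it from above.  The inequality results from comparing the two at
  \<open>y + (\<nabla>f(x) - \<nabla>f(y)) / L\<close>, the point where the upper bound exceeds the lower one by the least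
  amount.\<close>

lemma convex_L_smooth_lower_bound:
  fixes f :: "'a::euclidean_space \<Rightarrow> real"
  assumes "convex_on UNIV f" and "L > 0" and "L_smooth L f"
  shows "f y \<ge> f x + gradient f x \<bullet> (y - x) + (norm (gradient f x - gradient f y))\<^sup>2 / (2 * L)"
proof -
  define u where "u = gradient f x - gradient f y"
  define z where "z = y + (1 / L) *\<^sub>R u"
  have "f x + gradient f x \<bullet> (z - x) \<le> f z"
    using assms by (intro convex_on_above_gradient) (auto simp: L_smooth_def)
  also have "f z \<le> f y + gradient f y \<bullet> (z - y) + L / 2 * (norm (z - y))\<^sup>2"
    by (rule L_smooth_descent) fact
  finally have "f x + gradient f x \<bullet> (z - x)
      \<le> f y + gradient f y \<bullet> (z - y) + L / 2 * (norm (z - y))\<^sup>2" .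
  moreover have "gradient f x \<bullet> (z - x) = gradient f x \<bullet> (y - x) + gradient f x \<bullet> u / L"
    by (simp add: z_def inner_add_right inner_diff_right)
  moreover have "gradient f y \<bullet> (z - y) = gradient f x \<bullet> u / L - u \<bullet> u / L"
    by (simp add: z_def u_def inner_diff_left diff_divide_distrib)
  moreover have "L / 2 * (norm (z - y))\<^sup>2 = u \<bullet> u / (2 * L)"
    using assms(2) by (simp add: z_def power_divide power2_eq_square flip: power2_norm_eq_inner)
  ultimately show ?thesis
    by (simp add: power2_norm_eq_inner flip: u_def)
qed

lemma gradient_eq_0_at_minimizer:
  fixes f :: "'a::euclidean_space \<Rightarrow> real"
  assumes "f differentiable (at x)" and "\<And>y. f x \<le> f y"
  shows "gradient f x = 0"
proof -
  have "(f has_derivative (\<lambda>h. h \<bullet> gradient f x)) (at x)"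
    using GDERIV_gradient[OF assms(1)] unfolding gderiv_def .
  then have "(\<lambda>h. h \<bullet> gradient f x) = (\<lambda>h. 0)"
    using assms(2) by (intro differential_zero_maxmin[of x UNIV f]) auto
  then show ?thesis
    by (metis inner_eq_zero_iff)
qed

text \<open>Divided by \<open>sqrt e\<close> for positive \<open>e\<close>, this is concavity of the square root:
  \<open>sqrt (a + 1) - sqrt a \<le> 1 / (2 sqrt a)\<close>.\<close>

lemma sqrt_weight_increment:
  fixes a e :: real
  assumes "a > 0" and "e \<ge> 0"
  shows "2 * sqrt ((a + 1) * e) \<le> 2 * (a * sqrt (e / a)) + sqrt (e / a)"
proof -
  have "2 * sqrt ((a + 1) * e) = sqrt (4 * (a + 1) * e)"
    using real_sqrt_mult[of 4 "(a + 1) * e"] by (simp only: mult.assoc real_sqrt_four)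
  also have "\<dots> \<le> sqrt ((2 * a + 1)\<^sup>2 * (e / a))"
    using assms by (simp add: field_simps power2_eq_square)
  also have "\<dots> = (2 * a + 1) * sqrt (e / a)"
    using assms by (simp only: real_sqrt_mult real_sqrt_abs)
  finally show ?thesis by (simp add: algebra_simps)
qed

theorem lemma3:
  fixes f :: "real ^ 'n \<Rightarrow> real"
    and L :: real
    and xstar :: "real ^ 'n"
    and \<eta> :: "nat \<Rightarrow> real"
    and x :: "nat \<Rightarrow> real ^ 'n"
    and g :: "real ^ 'n \<Rightarrow> 'w \<Rightarrow> real ^ 'n"
    and \<xi> :: "nat \<Rightarrow> 'w"
    and k :: nat
  assumes "convex_on UNIV f"
    and "L > 0"
    and "L_smooth L f"
    and "\<And>y. f xstar \<le> f y"
    and "decseq \<eta>"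
    and "\<And>j. \<eta> j > 0"
    and "\<And>j. j \<ge> 1 \<Longrightarrow>
           x (j + 1) = x j + (real j / (real j + 2)) *\<^sub>R (x j - x (j - 1))
             - (2 * sqrt (\<eta> j) / ((real j + 2) * sqrt (real j))) *\<^sub>R g (x j) (\<xi> j)"
    and "k \<ge> 1"
  shows "energy f xstar \<eta> x k - energy f xstar \<eta> x (k - 1)
    \<le> 4 * \<eta> k / real k * (norm (g (x k) (\<xi> k)))\<^sup>2
      - 2 / L * sqrt (\<eta> k / real k) * (norm (gradient f (x k)))\<^sup>2
      - 2 * sqrt (\<eta> k / real k) * (f (x k) - f xstar)
      + 4 * sqrt (\<eta> k / real k) *
          ((gradient f (x k) - g (x k) (\<xi> k)) \<bullet> tau xstar x k)"
proof -
  define s where "s = sqrt (\<eta> k / real k)"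
  define G where "G = g (x k) (\<xi> k)"
  define \<tau> where "\<tau> = tau xstar x k"
  define F where "F j = f (x j) - f xstar" for j
  have k: "real k > 0" and \<eta>: "\<eta> k > 0"
    using assms(6,8) by auto
  have s: "s \<ge> 0" "s\<^sup>2 = \<eta> k / real k"
    using k \<eta> by (auto simp: s_def)
  have F: "F j \<ge> 0" for j
    using assms(4) by (simp add: F_def)
  have diff: "f differentiable (at y)" for y
    using assms(3) by (simp add: L_smooth_def)

  have step: "x (k + 1) + real (k + 1) *\<^sub>R (x (k + 1) - x k) - xstar = \<tau> - (2 * s) *\<^sub>R G"
  proof -
    have s_div: "2 * sqrt (\<eta> k) / ((real k + 2) * sqrt (real k)) = 2 * s / (real k + 2)"
      by (simp add: s_def real_sqrt_divide mult.commute)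
    have "x (k + 1) - x k
        = (1 / (real k + 2)) *\<^sub>R (real k *\<^sub>R (x k - x (k - 1)) - (2 * s) *\<^sub>R G)"
      unfolding assms(7)[OF assms(8)] s_div by (simp add: G_def scaleR_diff_right)
    then have "(real k + 2) *\<^sub>R (x (k + 1) - x k) = real k *\<^sub>R (x k - x (k - 1)) - (2 * s) *\<^sub>R G"
      using k by simp
    then show ?thesis
      by (simp add: \<tau>_def tau_def algebra_simps scaleR_2)
  qed
  have "(norm (\<tau> - (2 * s) *\<^sub>R G))\<^sup>2 = (norm \<tau>)\<^sup>2 - 4 * s * (G \<bullet> \<tau>) + 4 * s\<^sup>2 * (norm G)\<^sup>2"
    unfolding power2_norm_eq_inner
    by (simp add: inner_diff_left inner_diff_right inner_commute power2_eq_square)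
  then have energy_k: "energy f xstar \<eta> x k = (norm \<tau>)\<^sup>2 - 4 * s * (G \<bullet> \<tau>)
      + 4 * \<eta> k / real k * (norm G)\<^sup>2 + 4 * sqrt ((real k + 1) * \<eta> k) * F k"
    unfolding energy_def step F_def by (simp add: s(2) add.commute)
  have energy_prev: "energy f xstar \<eta> x (k - 1)
      = (norm \<tau>)\<^sup>2 + 4 * sqrt (real k * \<eta> (k - 1)) * F (k - 1)"
    using assms(8) by (simp add: energy_def \<tau>_def tau_def F_def algebra_simps)

  have "f xstar \<ge> f (x k) + gradient f (x k) \<bullet> (xstar - x k) + (norm (gradient f (x k)))\<^sup>2 / (2 * L)"
    using convex_L_smooth_lower_bound[OF assms(1-3), of "x k" xstar]
      gradient_eq_0_at_minimizer[OF diff assms(4)] by simp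
  moreover have "f (x (k - 1)) \<ge> f (x k) + gradient f (x k) \<bullet> (x (k - 1) - x k)"
    by (rule convex_on_above_gradient[OF assms(1) diff])
  then have "real k * (F k - F (k - 1)) \<le> real k * (gradient f (x k) \<bullet> (x k - x (k - 1)))"
    using k by (intro mult_left_mono) (auto simp: F_def inner_diff_right)
  ultimately have "real k * (F k - F (k - 1)) + F k + (norm (gradient f (x k)))\<^sup>2 / (2 * L)
      \<le> gradient f (x k) \<bullet> \<tau>"
    by (simp add: \<tau>_def tau_def inner_add_right inner_diff_right F_def)
  then have descent: "4 * s * (real k * (F k - F (k - 1)) + F k + (norm (gradient f (x k)))\<^sup>2 / (2 * L))
      \<le> 4 * s * (gradient f (x k) \<bullet> \<tau>)"
    using s by (intro mult_left_mono) auto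

  have "2 * sqrt ((real k + 1) * \<eta> k) * F k \<le> (2 * (real k * s) + s) * F k"
    using sqrt_weight_increment[OF k, of "\<eta> k"] \<eta> F by (intro mult_right_mono) (auto simp: s_def)
  moreover have "real k * s \<le> sqrt (real k * \<eta> (k - 1))"
  proof -
    have "real k * s = sqrt (real k * \<eta> k)"
      using k by (simp add: s_def real_sqrt_divide real_sqrt_mult field_simps)
    also have "\<dots> \<le> sqrt (real k * \<eta> (k - 1))"
      using decseqD[OF assms(5), of "k - 1" k] by (simp add: mult_left_mono)
    finally show ?thesis .
  qed
  then have "real k * s * F (k - 1) \<le> sqrt (real k * \<eta> (k - 1)) * F (k - 1)"
    using F by (intro mult_right_mono)
  ultimately show ?thesis
    using descent
    unfolding energy_k energy_prev
    unfolding s_def[symmetric] G_def[symmetric] \<tau>_def[symmetric] F_def[symmetric]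
    by (simp add: inner_diff_left algebra_simps)
qed

end
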